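(* Let $n\ge 2$ and let $\bm{m}=(m_1,\dots,m_n)$ be a vector of integers $m_i\ge 1$. Let $\bm 1_n$ be the all-one vector of length $n$ and let $D(\bm{m})$ be the integral covering graph of $\bm m$. Then \[\dim_{TH}(D(\bm{m}))=\begin{cases} n & \text{if } \bm{m}\ne\bm{1}_n,\\ 0 & \text{if } \bm{m}=\bm{1}_n \text{ and } n=2,\\ n-1 & \text{if } \bm{m}=\bm{1}_n \text{ and } n\ge 3. \end{cases}\]
   Context: $[n]=\{1,\dots,n\}$ and $[m]_0=\{0,1,\dots,m\}$. For $\bm{m}\in\mathbb{Z}_{\ge 1}^n$, the integral covering graph $D(\bm{m})$ has vertex set $\prod_{i=1}^n [m_i]_0\setminus\{\bm{0},\bm{m}\}$, where $\bm 0$ is the all-zero vector, and two distinct vertices $\bm v,\bm w$ are adjacent iff $v_i+w_i\ge m_i$ for all $i\in[n]$. For a finite set $V$, $\alpha\colon V\to\mathbb{R}$ and $S\in\mathbb{R}$, the threshold graph $T(\alpha,S)$ has vertex set $V$ and edges all $\{v,w\}$, $v\neq w$, with $\alpha(v)+\alpha(w)\ge S$; a graph is a threshold graph if it is of this form. The threshold dimension $\dim_{TH}(G)$ of a finite simple graph $G$ is the minimum $d\ge 0$ such that there exist $d$ threshold graphs $H_1,\dots,H_d$ on $V(G)$ with $E(G)=\bigcap_{j=1}^d E(H_j)$; the empty intersection ($d=0$) is the set of all pairs of vertices, so $\dim_{TH}(G)=0$ iff $G$ is complete. *)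

theory Defs
  imports Complex_Main "HOL-Library.FuncSet"
begin

text \<open>A graph is a pair (V, E), with edges given as two-element sets of vertices.\<close>

type_synonym 'a graph = "'a set \<times> 'a set set"

abbreviation verts :: "'a graph \<Rightarrow> 'a set" where "verts \<equiv> fst"
abbreviation edges :: "'a graph \<Rightarrow> 'a set set" where "edges \<equiv> snd"

definition all_pairs :: "'a set \<Rightarrow> 'a set set" where
  "all_pairs V = {{v, w} |v w. v \<in> V \<and> w \<in> V \<and> v \<noteq> w}"

definition finite_simple_graph :: "'a graph \<Rightarrow> bool" where
  "finite_simple_graph G \<longleftrightarrow> finite (verts G) \<and> edges G \<subseteq> all_pairs (verts G)"

definition threshold_graph_of :: "'a set \<Rightarrow> ('a \<Rightarrow> real) \<Rightarrow> real \<Rightarrow> 'a graph" where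
  "threshold_graph_of V \<alpha> S = (V, {{v, w} |v w. v \<in> V \<and> w \<in> V \<and> v \<noteq> w \<and> \<alpha> v + \<alpha> w \<ge> S})"

definition threshold_graph :: "'a graph \<Rightarrow> bool" where
  "threshold_graph H \<longleftrightarrow> (\<exists>V \<alpha> S. finite V \<and> H = threshold_graph_of V \<alpha> S)"

text \<open>Intersecting with \<^term>\<open>all_pairs (verts G)\<close> only matters for \<open>d = 0\<close>, where the
  intersection over the empty family is the universe of the type.\<close>

definition threshold_representable :: "'a graph \<Rightarrow> nat \<Rightarrow> bool" where
  "threshold_representable G d \<longleftrightarrow>
     (\<exists>H :: nat \<Rightarrow> 'a graph.
        (\<forall>j\<in>{1..d}. threshold_graph (H j) \<and> verts (H j) = verts G) \<and>
        edges G = all_pairs (verts G) \<inter> (\<Inter>j\<in>{1..d}. edges (H j)))"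

definition dim_TH :: "'a graph \<Rightarrow> nat" where
  "dim_TH G = (LEAST d. threshold_representable G d)"

text \<open>Vectors of length \<open>n\<close> are functions on \<open>{1..n}\<close> that are extensional, i.e. \<^term>\<open>undefined\<close>
  outside \<open>{1..n}\<close>, so that equality of vectors is equality of functions.\<close>

definition const_vec :: "nat \<Rightarrow> nat \<Rightarrow> nat \<Rightarrow> nat" where
  "const_vec n c = (\<lambda>i\<in>{1..n}. c)"

definition covering_verts :: "nat \<Rightarrow> (nat \<Rightarrow> nat) \<Rightarrow> (nat \<Rightarrow> nat) set" where
  "covering_verts n m = (\<Pi>\<^sub>E i\<in>{1..n}. {0..m i}) - {const_vec n 0, m}"

definition integral_covering_graph :: "nat \<Rightarrow> (nat \<Rightarrow> nat) \<Rightarrow> (nat \<Rightarrow> nat) graph" where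
  "integral_covering_graph n m = (covering_verts n m,
     {{v, w} |v w. v \<in> covering_verts n m \<and> w \<in> covering_verts n m \<and> v \<noteq> w \<and>
                   (\<forall>i\<in>{1..n}. v i + w i \<ge> m i)})"

lemma edges_threshold_graph_of_iff:
  "{v, w} \<in> edges (threshold_graph_of V \<alpha> S) \<longleftrightarrow> v \<in> V \<and> w \<in> V \<and> v \<noteq> w \<and> \<alpha> v + \<alpha> w \<ge> S"
  by (auto simp: threshold_graph_of_def doubleton_eq_iff add.commute)

lemma edges_integral_covering_graph_iff:
  "{v, w} \<in> edges (integral_covering_graph n m) \<longleftrightarrow>
     v \<in> covering_verts n m \<and> w \<in> covering_verts n m \<and> v \<noteq> w \<and> (\<forall>i\<in>{1..n}. v i + w i \<ge> m i)"
  by (auto simp: integral_covering_graph_def doubleton_eq_iff add.commute)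

lemma finite_simple_integral_covering_graph: "finite_simple_graph (integral_covering_graph n m)"
proof -
  have "finite (\<Pi>\<^sub>E i\<in>{1..n}. {0..m i})"
    by (rule finite_PiE) auto
  then show ?thesis
    by (auto simp: finite_simple_graph_def integral_covering_graph_def covering_verts_def all_pairs_def)
qed

text \<open>The minimum defining \<^const>\<open>dim_TH\<close> exists for every finite simple graph: each non-edge can
  be removed by a threshold graph of its own.\<close>

lemma threshold_graph_all_but_one:
  assumes "finite V" "e \<in> all_pairs V"
  shows "\<exists>H. threshold_graph H \<and> verts H = V \<and> edges H = all_pairs V - {e}"
proof -
  obtain a b where e: "e = {a, b}" "a \<in> V" "b \<in> V" "a \<noteq> b"
    using assms(2) by (auto simp: all_pairs_def)
  define \<alpha> :: "'a \<Rightarrow> real" where "\<alpha> x = (if x \<in> e then 0 else 1)" for x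
  have *: "\<alpha> v + \<alpha> w \<ge> 1 \<longleftrightarrow> {v, w} \<noteq> e" if "v \<noteq> w" for v w
    using that e by (auto simp: \<alpha>_def doubleton_eq_iff)
  have "edges (threshold_graph_of V \<alpha> 1) = all_pairs V - {e}"
  proof (intro equalityI subsetI)
    fix f assume "f \<in> edges (threshold_graph_of V \<alpha> 1)"
    then obtain v w where "f = {v, w}" "v \<in> V" "w \<in> V" "v \<noteq> w" "\<alpha> v + \<alpha> w \<ge> 1"
      by (auto simp: threshold_graph_of_def)
    with * show "f \<in> all_pairs V - {e}"
      unfolding all_pairs_def by blast
  next
    fix f assume "f \<in> all_pairs V - {e}"
    then obtain v w where "f = {v, w}" "v \<in> V" "w \<in> V" "v \<noteq> w" "{v, w} \<noteq> e"
      unfolding all_pairs_def by blast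
    with * show "f \<in> edges (threshold_graph_of V \<alpha> 1)"
      by (simp add: edges_threshold_graph_of_iff)
  qed
  moreover have "verts (threshold_graph_of V \<alpha> 1) = V"
    by (simp add: threshold_graph_of_def)
  moreover have "threshold_graph (threshold_graph_of V \<alpha> 1)"
    using assms(1) by (auto simp: threshold_graph_def)
  ultimately show ?thesis by blast
qed

lemma finite_all_pairs: "finite V \<Longrightarrow> finite (all_pairs V)"
  by (rule finite_subset[of _ "Pow V"]) (auto simp: all_pairs_def)

lemma ex_threshold_representable:
  assumes "finite_simple_graph G"
  shows "\<exists>d. threshold_representable G d"
proof -
  define V where "V = verts G"
  define N where "N = all_pairs V - edges G"
  have fin: "finite V" and sub: "edges G \<subseteq> all_pairs V"
    using assms by (auto simp: finite_simple_graph_def V_def)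
  have "finite N"
    using finite_all_pairs[OF fin] by (simp add: N_def)
  then obtain h where h: "bij_betw h {1..card N} N"
    using ex_bij_betw_nat_finite_1 by blast
  have "\<forall>e\<in>N. \<exists>H. threshold_graph H \<and> verts H = V \<and> edges H = all_pairs V - {e}"
    using threshold_graph_all_but_one[OF fin] by (simp add: N_def)
  then obtain F where F: "\<forall>e\<in>N. threshold_graph (F e) \<and> verts (F e) = V \<and>
      edges (F e) = all_pairs V - {e}"
    by metis
  have img: "h ` {1..card N} = N"
    using h by (simp add: bij_betw_def)
  have "(\<Inter>j\<in>{1..card N}. edges (F (h j))) = (\<Inter>e\<in>h ` {1..card N}. edges (F e))"
    by blast
  also have "\<dots> = (\<Inter>e\<in>N. edges (F e))"
    by (simp only: img)
  also have "\<dots> = (\<Inter>e\<in>N. all_pairs V - {e})"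
    using F by auto
  finally have "edges G = all_pairs V \<inter> (\<Inter>j\<in>{1..card N}. edges (F (h j)))"
    using sub by (auto simp: N_def)
  moreover have "threshold_graph (F (h j)) \<and> verts (F (h j)) = V" if "j \<in> {1..card N}" for j
    using F img that by blast
  ultimately have "threshold_representable G (card N)"
    unfolding threshold_representable_def V_def
    by (intro exI[of _ "\<lambda>j. F (h j)"]) simp
  then show ?thesis ..
qed

lemma threshold_representable_dim_TH:
  "finite_simple_graph G \<Longrightarrow> threshold_representable G (dim_TH G)"
  unfolding dim_TH_def by (rule LeastI_ex) (rule ex_threshold_representable)

lemma dim_TH_eq_0_iff:
  assumes "finite_simple_graph G"
  shows "dim_TH G = 0 \<longleftrightarrow> edges G = all_pairs (verts G)"
proof -
  have 0: "threshold_representable G 0 \<longleftrightarrow> edges G = all_pairs (verts G)"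
    by (simp add: threshold_representable_def)
  show ?thesis
  proof
    assume "dim_TH G = 0"
    then show "edges G = all_pairs (verts G)"
      using threshold_representable_dim_TH[OF assms] 0 by simp
  next
    assume "edges G = all_pairs (verts G)"
    then have "threshold_representable G 0"
      using 0 by simp
    then show "dim_TH G = 0"
      unfolding dim_TH_def by (rule Least_eq_0)
  qed
qed

end

theory Submission
  imports Defs
begin

text \<open>Coordinatewise thresholds represent \<open>D(m)\<close> by \<open>n\<close> threshold graphs. For \<open>m = 1\<close>, pass to the
  zero sets of the vertices, which are adjacent iff disjoint: distinct sets that meet only in \<open>n\<close>
  are not both \<open>{n}\<close>, so one of them contains some \<open>i < n\<close>, and the \<open>i\<close>-th threshold graph can be
  modified to separate this pair as well; the \<open>n\<close>-th graph is then superfluous.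
  For the lower bounds, if \<open>{x, y}\<close> and \<open>{x', y'}\<close> are non-edges while \<open>{x, y'}\<close> and \<open>{x', y}\<close> are
  edges, then no threshold graph containing the edges misses both non-edges. So it suffices to
  exhibit as many non-edges, pairwise in this position, as the claimed dimension.\<close>

section \<open>Threshold representations and a lower bound criterion\<close>

lemma threshold_representableI:
  fixes \<alpha> :: "nat \<Rightarrow> 'a \<Rightarrow> real" and S :: "nat \<Rightarrow> real"
  assumes "finite_simple_graph G"
    and "\<And>v w. v \<in> verts G \<Longrightarrow> w \<in> verts G \<Longrightarrow> v \<noteq> w \<Longrightarrow>
      {v, w} \<in> edges G \<longleftrightarrow> (\<forall>j\<in>{1..d}. \<alpha> j v + \<alpha> j w \<ge> S j)"
  shows "threshold_representable G d"
proof -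
  define H where "H j = threshold_graph_of (verts G) (\<alpha> j) (S j)" for j
  have sub: "edges G \<subseteq> all_pairs (verts G)"
    using assms(1) by (simp add: finite_simple_graph_def)
  have "{v, w} \<in> edges G \<longleftrightarrow> (\<forall>j\<in>{1..d}. {v, w} \<in> edges (H j))"
    if "v \<in> verts G" "w \<in> verts G" "v \<noteq> w" for v w
    using that assms(2) by (simp add: H_def edges_threshold_graph_of_iff)
  then have "e \<in> edges G \<longleftrightarrow> (\<forall>j\<in>{1..d}. e \<in> edges (H j))" if "e \<in> all_pairs (verts G)" for e
    using that unfolding all_pairs_def by blast
  then have "edges G = all_pairs (verts G) \<inter> (\<Inter>j\<in>{1..d}. edges (H j))"
    using sub by blast
  moreover have "threshold_graph (H j) \<and> verts (H j) = verts G" for j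
    using assms(1) unfolding H_def threshold_graph_def finite_simple_graph_def
    by (auto simp: threshold_graph_of_def)
  ultimately show ?thesis
    unfolding threshold_representable_def by blast
qed

text \<open>Both pairings of the four vertices have the same total weight. The two edges make it at
  least \<open>2 * S\<close>, so one of the other two pairs reaches \<open>S\<close>.\<close>

lemma threshold_graph_no_alternating_square:
  assumes "threshold_graph H" "{x, y'} \<in> edges H" "{x', y} \<in> edges H" "x \<noteq> y" "x' \<noteq> y'"
  shows "{x, y} \<in> edges H \<or> {x', y'} \<in> edges H"
proof -
  obtain V \<alpha> S where "H = threshold_graph_of V \<alpha> S"
    using assms(1) by (auto simp: threshold_graph_def)
  then show ?thesis
    using assms(2-) by (auto simp: edges_threshold_graph_of_iff)
qed

text \<open>Choosing for each \<open>i\<close> a threshold graph that misses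
  \<open>{x i, y i}\<close> is injective: a graph shared by \<open>i\<close> and \<open>j\<close>
  would still contain \<open>{x i, y j}\<close> and \<open>{x j, y i}\<close>.\<close>

lemma card_le_of_threshold_representable:
  assumes rep: "threshold_representable G d"
    and verts: "\<And>i. i \<in> I \<Longrightarrow> x i \<in> verts G \<and> y i \<in> verts G \<and> x i \<noteq> y i"
    and non_edge: "\<And>i. i \<in> I \<Longrightarrow> {x i, y i} \<notin> edges G"
    and edge: "\<And>i j. i \<in> I \<Longrightarrow> j \<in> I \<Longrightarrow> i \<noteq> j \<Longrightarrow> {x i, y j} \<in> edges G"
  shows "card I \<le> d"
proof -
  obtain H where H: "\<And>j. j \<in> {1..d} \<Longrightarrow> threshold_graph (H j)"
    and G: "edges G = all_pairs (verts G) \<inter> (\<Inter>j\<in>{1..d}. edges (H j))"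
    using rep unfolding threshold_representable_def by blast
  have "\<exists>j\<in>{1..d}. {x i, y i} \<notin> edges (H j)" if "i \<in> I" for i
  proof -
    have "{x i, y i} \<in> all_pairs (verts G)"
      using verts[OF that] unfolding all_pairs_def by blast
    then show ?thesis
      using non_edge[OF that] G by blast
  qed
  then obtain f where f: "\<And>i. i \<in> I \<Longrightarrow> f i \<in> {1..d} \<and> {x i, y i} \<notin> edges (H (f i))"
    by metis
  have "inj_on f I"
  proof (rule inj_onI, rule ccontr)
    fix i j assume ij: "i \<in> I" "j \<in> I" "f i = f j" "i \<noteq> j"
    then have "{x i, y j} \<in> edges (H (f i))" "{x j, y i} \<in> edges (H (f i))"
      using edge[of i j] edge[of j i] f[of i] G by auto
    then show False
      using threshold_graph_no_alternating_square H f ij verts by metis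
  qed
  moreover have "f ` I \<subseteq> {1..d}"
    using f by blast
  ultimately show ?thesis
    using card_inj_on_le[of f I "{1..d}"] by simp
qed

section \<open>Covering graphs of general vectors\<close>

lemma verts_integral_covering_graph [simp]:
  "verts (integral_covering_graph n m) = covering_verts n m"
  by (simp add: integral_covering_graph_def)

lemma covering_vertsI:
  assumes "v \<in> (\<Pi>\<^sub>E i\<in>{1..n}. {0..m i})"
    and "i \<in> {1..n}" "v i \<noteq> 0" and "j \<in> {1..n}" "v j \<noteq> m j"
  shows "v \<in> covering_verts n m"
proof -
  have "v \<noteq> const_vec n 0"
    using assms(2,3) by (auto simp: const_vec_def)
  moreover have "v \<noteq> m"
    using assms(5) by auto
  ultimately show ?thesis
    using assms(1) by (simp add: covering_verts_def)
qed

lemma threshold_representable_coordinates: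
  "threshold_representable (integral_covering_graph n m) n"
  by (rule threshold_representableI[OF finite_simple_integral_covering_graph,
        where \<alpha> = "\<lambda>i v. real (v i)" and S = "\<lambda>i. real (m i)"])
    (simp add: edges_integral_covering_graph_iff flip: of_nat_add)

lemma le_of_threshold_representable:
  assumes "n \<ge> 2" and m: "m \<in> {1..n} \<rightarrow>\<^sub>E {1..}" and "m \<noteq> const_vec n 1"
    and rep: "threshold_representable (integral_covering_graph n m) d"
  shows "n \<le> d"
proof -
  have pos: "m i \<ge> 1" if "i \<in> {1..n}" for i
    using m that by auto
  have ext: "m i = undefined" if "i \<notin> {1..n}" for i
    using m that by auto
  obtain k where k: "k \<in> {1..n}" "m k \<noteq> 1"
  proof (rule ccontr)
    assume "\<not> thesis"
    with that have "m i = 1" if "i \<in> {1..n}" for i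
      using \<open>i \<in> {1..n}\<close> by blast
    with ext have "m = const_vec n 1"
      by (auto simp: const_vec_def fun_eq_iff restrict_def)
    with assms(3) show False by simp
  qed
  with pos have k2: "m k \<ge> 2"
    by (metis One_nat_def Suc_1 Suc_leI le_neq_implies_less)
  \<comment> \<open>A second coordinate, available as \<open>n \<ge> 2\<close>, keeps
    \<open>m(k := 0)\<close>, the vector \<open>y k\<close> below, from being zero.\<close>
  obtain l where l: "l \<in> {1..n}" "l \<noteq> k"
    using assms(1) that[of 1] that[of 2] by fastforce
  \<comment> \<open>\<open>x i\<close> and \<open>y i\<close> fail to cover \<open>m\<close> only at
    \<open>i\<close>. Lowering \<open>y i\<close> at \<open>k\<close> makes it differ from
    \<open>x i\<close> when \<open>i \<noteq> k\<close>. It does no harm to the edges: even two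
    entries \<open>m k - 1\<close> cover \<open>m k\<close>, because
    \<open>m k \<ge> 2\<close>.\<close>
  define x where "x i = (if i = k then m(k := m k - 1) else m(i := 0))" for i
  define y where "y i = (if i = k then m(k := 0) else m(i := 0, k := m k - 1))" for i
  have xV: "x i \<in> covering_verts n m" if i: "i \<in> {1..n}" for i
    by (rule covering_vertsI[OF _ k(1) _ i])
      (use k k2 pos[OF i] i ext in \<open>auto simp: x_def PiE_iff extensional_def\<close>)
  have yV: "y i \<in> covering_verts n m" if i: "i \<in> {1..n}" for i
    by (rule covering_vertsI[OF _ _ _ i, of _ _ "if i = k then l else k"])
      (use k k2 pos[OF i] i ext l pos[OF l(1)] in \<open>auto simp: y_def PiE_iff extensional_def\<close>)
  have "card {1..n} \<le> d"
  proof (rule card_le_of_threshold_representable[OF rep, of _ x y];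
      (unfold verts_integral_covering_graph)?)
    fix i assume i: "i \<in> {1..n}"
    have "x i k \<noteq> y i k"
      using k2 by (auto simp: x_def y_def)
    then show "x i \<in> covering_verts n m \<and> y i \<in> covering_verts n m \<and> x i \<noteq> y i"
      using xV[OF i] yV[OF i] by auto
    have "x i i + y i i < m i"
      using pos[OF i] by (auto simp: x_def y_def)
    then show "{x i, y i} \<notin> edges (integral_covering_graph n m)"
      using i by (auto simp: edges_integral_covering_graph_iff not_le)
  next
    fix i j assume ij: "i \<in> {1..n}" "j \<in> {1..n}" "i \<noteq> j"
    \<comment> \<open>For \<open>i = k\<close> both vectors have the entry \<open>m k - 1\<close> at
      \<open>k\<close>, so they are compared at \<open>j\<close>, where only \<open>y j\<close>
      vanishes.\<close>
    have "x i (if i = k then j else k) \<noteq> y j (if i = k then j else k)"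
      using ij k2 pos[OF ij(2)] by (auto simp: x_def y_def)
    then have "x i \<noteq> y j" by auto
    moreover have "m t \<le> x i t + y j t" for t
      using ij k2 by (auto simp: x_def y_def)
    ultimately show "{x i, y j} \<in> edges (integral_covering_graph n m)"
      using xV[OF ij(1)] yV[OF ij(2)] by (simp add: edges_integral_covering_graph_iff)
  qed
  then show ?thesis by simp
qed

section \<open>The all-one vector\<close>

lemma const_vec_nth [simp]: "i \<in> {1..n} \<Longrightarrow> const_vec n c i = c"
  by (simp add: const_vec_def)

lemma covering_verts_ones_le:
  "v \<in> covering_verts n (const_vec n 1) \<Longrightarrow> i \<in> {1..n} \<Longrightarrow> v i \<le> 1"
  by (fastforce simp: covering_verts_def PiE_iff)

lemma covering_verts_extensional: "v \<in> covering_verts n m \<Longrightarrow> v \<in> extensional {1..n}"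
  by (simp add: covering_verts_def PiE_def)

lemma threshold_representable_ones:
  assumes "n \<ge> 2"
  shows "threshold_representable (integral_covering_graph n (const_vec n 1)) (n - 1)"
proof -
  \<comment> \<open>The pairs separated by \<open>\<alpha> i\<close> are those whose weights \<open>- \<alpha> i\<close> sum to at least 6: two zero sets containing \<open>i\<close>
    give at least 3 + 3, one containing \<open>i\<close> and \<open>n\<close> and one containing \<open>n\<close> give at least 4 + 2,
    while the possibly disjoint \<open>i \<in> X\<close>, \<open>n \<notin> X\<close> and \<open>n \<in> Y\<close>, \<open>i \<notin> Y\<close> give only 3 + 2.\<close>
  define \<alpha> :: "nat \<Rightarrow> (nat \<Rightarrow> nat) \<Rightarrow> real" where
    "\<alpha> i v = - (if v i = 0 then if v n = 0 then 4 else 3 else if v n = 0 then 2 else 0)" for i v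
  let ?V = "covering_verts n (const_vec n 1)"
  show ?thesis
  proof (rule threshold_representableI[OF finite_simple_integral_covering_graph,
        where \<alpha> = \<alpha> and S = "\<lambda>_. - 5"]; (unfold verts_integral_covering_graph)?)
    fix v w assume v: "v \<in> ?V" and w: "w \<in> ?V" and "v \<noteq> w"
    have v01: "v i = 0 \<or> v i = 1" and w01: "w i = 0 \<or> w i = 1" if "i \<in> {1..n}" for i
      using covering_verts_ones_le[OF v that] covering_verts_ones_le[OF w that] by linarith+
    \<comment> \<open>The \<open>i\<close>-th graph tests coordinate \<open>i\<close> in full, and
      coordinate \<open>n\<close> except when both entries at \<open>i\<close> are 1.\<close>
    have step: "\<alpha> i v + \<alpha> i w \<ge> - 5 \<longleftrightarrow> v i + w i \<ge> 1 \<and> (v n + w n \<ge> 1 \<or> v i = 1 \<and> w i = 1)"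
      if "i \<in> {1..n - 1}" for i
    proof -
      have "i \<in> {1..n}" "n \<in> {1..n}" using that by auto
      from v01[OF this(1)] w01[OF this(1)] v01[OF this(2)] w01[OF this(2)] show ?thesis
        unfolding \<alpha>_def by (elim disjE) simp_all
    qed
    \<comment> \<open>If both vectors vanished at \<open>n\<close>, all their other entries would be
      1, making them equal.\<close>
    have "v n + w n \<ge> 1" if both: "\<forall>i\<in>{1..n - 1}. v n + w n \<ge> 1 \<or> v i = 1 \<and> w i = 1"
    proof (rule ccontr)
      assume *: "\<not> v n + w n \<ge> 1"
      have "v i = w i" if "i \<in> {1..n}" for i
        using * both that by (cases "i = n") auto
      with v w have "v = w"
        by (blast intro: extensionalityI covering_verts_extensional)
      with \<open>v \<noteq> w\<close> show False ..
    qed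
    moreover have "{1..n} = insert n {1..n - 1}"
      using assms by auto
    ultimately have "(\<forall>i\<in>{1..n}. v i + w i \<ge> 1) \<longleftrightarrow> (\<forall>i\<in>{1..n - 1}. \<alpha> i v + \<alpha> i w \<ge> - 5)"
      using step assms by auto
    then show "{v, w} \<in> edges (integral_covering_graph n (const_vec n 1)) \<longleftrightarrow>
        (\<forall>i\<in>{1..n - 1}. \<alpha> i v + \<alpha> i w \<ge> - 5)"
      using v w \<open>v \<noteq> w\<close> by (simp add: edges_integral_covering_graph_iff)
  qed
qed

lemma le_of_threshold_representable_ones:
  assumes "n \<ge> 3" and rep: "threshold_representable (integral_covering_graph n (const_vec n 1)) d"
  shows "n - 1 \<le> d"
proof -
  let ?V = "covering_verts n (const_vec n 1)"
  \<comment> \<open>The extra zero at \<open>n\<close> separates \<open>y i\<close> from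
    \<open>x i\<close>. This uses up coordinate \<open>n\<close>, leaving \<open>n - 1\<close>
    indices.\<close>
  define x where "x i = (const_vec n 1)(i := 0)" for i
  define y where "y i = (const_vec n 1)(i := 0, n := 0)" for i
  have n: "n \<in> {1..n}" using assms(1) by simp
  have ext: "const_vec n 1 i = undefined" if "i \<notin> {1..n}" for i
    using that by (auto simp: const_vec_def)
  have xV: "x i \<in> ?V" if i: "i \<in> {1..n - 1}" for i
    by (rule covering_vertsI[of _ _ _ n i])
      (use i assms(1) ext in \<open>auto simp: x_def PiE_iff extensional_def\<close>)
  \<comment> \<open>As \<open>n \<ge> 3\<close>, some coordinate other than \<open>i\<close> and
    \<open>n\<close> remains where \<open>y i\<close> is 1.\<close>
  have yV: "y i \<in> ?V" if i: "i \<in> {1..n - 1}" for i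
    by (rule covering_vertsI[of _ _ _ "if i = 1 then 2 else 1" i])
      (use i assms(1) ext in \<open>auto simp: y_def PiE_iff extensional_def\<close>)
  have ne: "x i \<noteq> y j" if "i \<in> {1..n - 1}" for i j
  proof -
    have "x i n \<noteq> y j n"
      using that n by (auto simp: x_def y_def)
    then show ?thesis by auto
  qed
  have "card {1..n - 1} \<le> d"
  proof (rule card_le_of_threshold_representable[OF rep, of _ x y];
      (unfold verts_integral_covering_graph)?)
    fix i assume i: "i \<in> {1..n - 1}"
    show "x i \<in> ?V \<and> y i \<in> ?V \<and> x i \<noteq> y i"
      using xV[OF i] yV[OF i] ne[OF i] by auto
    have "i \<in> {1..n}" "x i i + y i i < const_vec n 1 i"
      using i by (auto simp: x_def y_def)
    then show "{x i, y i} \<notin> edges (integral_covering_graph n (const_vec n 1))"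
      by (auto simp: edges_integral_covering_graph_iff not_le)
  next
    fix i j assume ij: "i \<in> {1..n - 1}" "j \<in> {1..n - 1}" "i \<noteq> j"
    have "1 \<le> x i t + y j t" if "t \<in> {1..n}" for t
      using ij n that by (auto simp: x_def y_def)
    then show "{x i, y j} \<in> edges (integral_covering_graph n (const_vec n 1))"
      using xV[OF ij(1)] yV[OF ij(2)] ne[OF ij(1)]
      by (simp add: edges_integral_covering_graph_iff)
  qed
  then show ?thesis by simp
qed

text \<open>Once the two constant vectors are removed, only (1,0) and (0,1) remain, and they sum to
  the all-one vector.\<close>

lemma edges_integral_covering_graph_ones_2:
  "edges (integral_covering_graph 2 (const_vec 2 1)) = all_pairs (covering_verts 2 (const_vec 2 1))"
proof -
  let ?V = "covering_verts 2 (const_vec 2 1)"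
  have I: "{Suc 0..2} = {Suc 0, 2}" by auto
  have sum: "v 1 + v 2 = 1" if "v \<in> ?V" for v
  proof -
    have eq: "v = const_vec 2 c" if "v 1 = c" "v 2 = c" for c
      using covering_verts_extensional[OF \<open>v \<in> ?V\<close>]
      by (rule extensionalityI) (use that in \<open>auto simp: const_vec_def I\<close>)
    have "v 1 \<le> 1" "v 2 \<le> 1"
      using covering_verts_ones_le[OF that] by auto
    moreover have "v \<noteq> const_vec 2 0" "v \<noteq> const_vec 2 1"
      using that by (auto simp: covering_verts_def)
    ultimately show ?thesis
      using eq[of 0] eq[of 1] by linarith
  qed
  have "v 1 + w 1 \<ge> 1 \<and> v 2 + w 2 \<ge> 1" if vw: "v \<in> ?V" "w \<in> ?V" "v \<noteq> w" for v w
  proof -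
    have "v = w" if "v 1 = w 1"
      using covering_verts_extensional[OF vw(1)] covering_verts_extensional[OF vw(2)]
      by (rule extensionalityI) (use sum[OF vw(1)] sum[OF vw(2)] that in \<open>auto simp: I\<close>)
    with vw(3) have "v 1 \<noteq> w 1" by auto
    then show ?thesis using sum[OF vw(1)] sum[OF vw(2)] by linarith
  qed
  then have "{v, w} \<in> edges (integral_covering_graph 2 (const_vec 2 1))"
    if "v \<in> ?V" "w \<in> ?V" "v \<noteq> w" for v w
    using that by (auto simp: edges_integral_covering_graph_iff I)
  then have "all_pairs ?V \<subseteq> edges (integral_covering_graph 2 (const_vec 2 1))"
    unfolding all_pairs_def by blast
  then show ?thesis
    using finite_simple_integral_covering_graph[of 2 "const_vec 2 1"]
    by (auto simp: finite_simple_graph_def)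
qed

theorem theorem43:
  fixes n :: nat and m :: "nat \<Rightarrow> nat"
  assumes "n \<ge> 2"
    and "m \<in> {1..n} \<rightarrow>\<^sub>E {1..}"
  shows "dim_TH (integral_covering_graph n m) =
    (if m \<noteq> const_vec n 1 then n
     else if n = 2 then 0
     else n - 1)"
proof -
  consider "m \<noteq> const_vec n 1" | "m = const_vec n 1" "n = 2" | "m = const_vec n 1" "n \<ge> 3"
    using assms(1) by linarith
  then show ?thesis
  proof cases
    case 1
    then have "dim_TH (integral_covering_graph n m) = n"
      unfolding dim_TH_def
      by (intro Least_equality threshold_representable_coordinates
          le_of_threshold_representable[OF assms])
    with 1 show ?thesis by simp
  next
    case 2
    then show ?thesis
      using edges_integral_covering_graph_ones_2
      by (simp add: dim_TH_eq_0_iff[OF finite_simple_integral_covering_graph])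
  next
    case 3
    then have "dim_TH (integral_covering_graph n m) = n - 1"
      unfolding dim_TH_def
      using threshold_representable_ones[OF assms(1)] le_of_threshold_representable_ones
      by (intro Least_equality) auto
    with 3 show ?thesis by simp
  qed
qed

end
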